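(* Let $S \subseteq \mathbb{Q}^2$ be a set of points in the plane with rational coordinates, and let $R, P, Q, T \in S$ be such that the lines $RQ$ and $PT$ are parallel (and distinct), and suppose that the line $RP$ is not parallel to the line $QT$. Then $\bigcup_{i \geq 0} \mathcal{T}^{i}(S) = \mathbb{Q}^2$.
   Context: For a set $S \subseteq \mathbb{R}^2$, let $L = \{L_i\}_{i\in I}$ be the set of lines passing through pairs of (distinct) points of $S$. Define $\mathcal{T}(S) = \bigcup_{i \neq j} L_i \cap L_j \subseteq \mathbb{R}^2$, i.e. the set of intersection points between pairs of distinct lines in $L$. If $S$ is empty or consists of collinear points, then $\mathcal{T}(S) = \emptyset$. The iterates are $\mathcal{T}^0(S) = S$ and $\mathcal{T}^{i+1}(S) = \mathcal{T}(\mathcal{T}^i(S))$. Here $RQ$ denotes the line through $R$ and $Q$, and similarly for the other pairs, so the two points in each pair are distinct.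
   Formalization: The formal theorem also assumes that RT is not parallel to QP: otherwise RP and QT may be the diagonals of a parallelogram, and the claim fails for S = {(0,0), (1,0), (1,1), (0,1)}, whose iterates add only the centre. *)

theory Defs
  imports "HOL-Analysis.Analysis"
begin

abbreviation line_through :: "real \<times> real \<Rightarrow> real \<times> real \<Rightarrow> (real \<times> real) set" where
  "line_through A B \<equiv> affine hull {A, B}"

definition spanned_lines :: "(real \<times> real) set \<Rightarrow> (real \<times> real) set set" where
  "spanned_lines S = {line_through A B | A B. A \<in> S \<and> B \<in> S \<and> A \<noteq> B}"

definition intersection_points :: "(real \<times> real) set \<Rightarrow> (real \<times> real) set" where
  "intersection_points S =
     (\<Union>l \<in> spanned_lines S. \<Union>m \<in> spanned_lines S - {l}. l \<inter> m)"

text \<open>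
  Parallelism of lines is \<^const>\<open>affine_parallel\<close> (one line is a translate of the other), so
  a line counts as parallel to itself.

  For points with \<open>RQ\<close> and \<open>PT\<close> parallel and distinct, requiring only that \<open>RP\<close> is not parallel
  to \<open>QT\<close> does not exclude a parallelogram in which \<open>RP\<close> and \<open>QT\<close> are the diagonals. The
  four vertices of a parallelogram generate nothing beyond themselves and its centre: for
  \<open>R = (0,0)\<close>, \<open>Q = (1,0)\<close>, \<open>P = (1,1)\<close>, \<open>T = (0,1)\<close> the only new point is \<open>(1/2,1/2)\<close>.
  Hence the trapezoid must be assumed not to be a parallelogram in either labelling of the
  endpoints: neither \<open>RP\<close> and \<open>QT\<close>, nor \<open>RT\<close> and \<open>QP\<close>, are parallel.
\<close>

end

theory Submission
  imports Defs
begin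

text \<open>
  The union \<open>U\<close> of the iterates is closed under intersecting lines: a noncollinear set is contained
  in its set of intersection points, so the iterates increase and any four points of \<open>U\<close> already
  lie in one of them. It consists of rational points because two distinct lines with rational
  equations meet, by Cramer's rule, in a rational point.

  For the converse inclusion, an affine change of coordinates turns \<open>R, Q, P, T\<close> into \<open>(0,0), (1,0),
  (0,1), (t,1)\<close> with \<open>t\<close> rational. Parallel and distinct lines \<open>RQ\<close> and \<open>PT\<close> make these coordinates
  possible, with \<open>t \<noteq> 0\<close> as \<open>P \<noteq> T\<close>; excluding parallelograms gives \<open>t \<noteq> 1\<close> and \<open>t \<noteq> -1\<close>. Let \<open>X\<close> and
  \<open>Y\<close> be the sets of abscissae of the points of \<open>U\<close> at heights \<open>0\<close> and \<open>1\<close>. Given two points of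
  each row, the two lines that join them in pairs meet in a point of \<open>U\<close>, unless they are parallel.
  Projecting one row to the other from this point is an affine map between \<open>X\<close> and \<open>Y\<close>
  (\<open>row_perspectivity\<close>). In a trapezoid, moreover, the line through the intersection of the
  legs and the intersection of the diagonals bisects the parallel sides (\<open>row_midpoint\<close>).

  These two constructions suffice to do arithmetic on \<open>X\<close>. Midpoints give halving; a scaling
  from \<open>X\<close> to \<open>Y\<close> followed by a different scaling back gives doubling, hence addition; a
  reflection gives negation; and a scaling by \<open>y t / z\<close> followed by a division by \<open>t\<close> gives
  \<open>x \<mapsto> x y / z\<close>. So \<open>X\<close> is a subfield of the reals, it contains \<open>\<rat>\<close>, and so does \<open>Y = t X\<close>.
  Finally every rational point off the bottom row lies on two different lines joining rational
  points of the two rows.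
\<close>

section \<open>Lines in the plane\<close>

definition det2 :: "real \<times> real \<Rightarrow> real \<times> real \<Rightarrow> real" where
  "det2 u v = fst u * snd v - snd u * fst v"

lemma in_line_throughI:
  fixes A B :: "real \<times> real"
  assumes "z = A + u *\<^sub>R (B - A)"
  shows "z \<in> line_through A B"
  using assms by (auto simp: affine_hull_2_alt)

lemma line_through_eq_det2:
  assumes "A \<noteq> B"
  shows "line_through A B = {z. det2 (B - A) (z - A) = 0}"
proof (intro equalityI subsetI)
  fix z assume "z \<in> line_through A B"
  then obtain u where "z = A + u *\<^sub>R (B - A)"
    by (auto simp: affine_hull_2_alt)
  then show "z \<in> {z. det2 (B - A) (z - A) = 0}"
    by (simp add: det2_def)
next
  fix z assume z: "z \<in> {z. det2 (B - A) (z - A) = 0}"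
  define d where "d = B - A"
  have e: "fst d * snd (z - A) = snd d * fst (z - A)"
    using z by (simp add: det2_def d_def)
  define u where "u = (if fst d = 0 then snd (z - A) / snd d else fst (z - A) / fst d)"
  have "fst d \<noteq> 0 \<or> snd d \<noteq> 0"
    using assms by (auto simp: d_def prod_eq_iff)
  then have "z - A = u *\<^sub>R d"
    using e by (auto simp: prod_eq_iff u_def field_simps)
  then have "z = A + u *\<^sub>R (B - A)"
    by (simp add: d_def algebra_simps)
  then show "z \<in> line_through A B"
    by (rule in_line_throughI)
qed

lemma intersection_pointsI:
  assumes "A \<in> S" "B \<in> S" "C \<in> S" "D \<in> S" "A \<noteq> B" "C \<noteq> D"
    and "line_through A B \<noteq> line_through C D"
    and "z \<in> line_through A B" "z \<in> line_through C D"
  shows "z \<in> intersection_points S"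
  using assms unfolding intersection_points_def spanned_lines_def by blast

lemma intersection_pointsE:
  assumes "z \<in> intersection_points S"
  obtains A B C D where "A \<in> S" "B \<in> S" "C \<in> S" "D \<in> S" "A \<noteq> B" "C \<noteq> D"
    "line_through A B \<noteq> line_through C D"
    "z \<in> line_through A B" "z \<in> line_through C D"
  using assms unfolding intersection_points_def spanned_lines_def by blast

lemma intersection_points_mono:
  assumes "S \<subseteq> S'"
  shows "intersection_points S \<subseteq> intersection_points S'"
proof -
  have "spanned_lines S \<subseteq> spanned_lines S'"
    using assms unfolding spanned_lines_def by blast
  then show ?thesis unfolding intersection_points_def by blast
qed

text \<open>
  Each point \<open>z\<close> of \<open>S\<close> lies on two different lines: pick a second point \<open>q\<close>, and a point \<open>r\<close> off the
  line \<open>z q\<close>.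
\<close>

lemma intersection_points_extensive:
  assumes "\<not> collinear S"
  shows "S \<subseteq> intersection_points S"
proof
  fix z assume z: "z \<in> S"
  obtain q where q: "q \<in> S" "q \<noteq> z"
    using assms collinear_subset[OF collinear_sing[of z], of S] by blast
  obtain r where r: "r \<in> S" "r \<notin> line_through z q"
    using assms unfolding collinear_affine_hull by blast
  have "z \<in> line_through z q" "z \<in> line_through z r" "r \<in> line_through z r"
    by (auto intro: hull_inc)
  moreover have "line_through z q \<noteq> line_through z r"
    using r(2) calculation(3) by metis
  moreover have "z \<noteq> r"
    using r(2) calculation(1) by metis
  ultimately show "z \<in> intersection_points S"
    using z q r(1) by (intro intersection_pointsI[of z S q z r]) auto
qed

text \<open>
  Cramer's rule, applied to the equations \<open>det2 a (z - A) = 0\<close> and \<open>det2 c (z - C) = 0\<close> of the two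
  lines. The determinant \<open>det2 a c\<close> of the system does not vanish, since two lines with the same
  direction and a common point \<open>z\<close> coincide.
\<close>

lemma intersection_points_rational:
  assumes "S \<subseteq> \<rat> \<times> \<rat>"
  shows "intersection_points S \<subseteq> \<rat> \<times> \<rat>"
proof
  fix z assume "z \<in> intersection_points S"
  then obtain A B C D where m: "A \<in> S" "B \<in> S" "C \<in> S" "D \<in> S" and ne: "A \<noteq> B" "C \<noteq> D"
    and ln: "line_through A B \<noteq> line_through C D"
    and zl: "z \<in> line_through A B" "z \<in> line_through C D"
    by (rule intersection_pointsE)
  define a where "a = B - A"
  define c where "c = D - C"
  have rat: "fst A \<in> \<rat>" "snd A \<in> \<rat>" "fst C \<in> \<rat>" "snd C \<in> \<rat>"
      "fst a \<in> \<rat>" "snd a \<in> \<rat>" "fst c \<in> \<rat>" "snd c \<in> \<rat>"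
    using subsetD[OF assms m(1)] subsetD[OF assms m(2)] subsetD[OF assms m(3)] subsetD[OF assms m(4)]
    by (auto simp: a_def c_def)
  have z1: "det2 a (z - A) = 0" and z2: "det2 c (z - C) = 0"
    using zl ne by (auto simp: line_through_eq_det2 a_def c_def)
  have "det2 a c \<noteq> 0"
  proof
    assume p: "det2 a c = 0"
    obtain k where k: "c = k *\<^sub>R a"
    proof -
      have "c \<in> line_through 0 a"
        using p ne by (subst line_through_eq_det2) (auto simp: a_def)
      then show ?thesis using that by (auto simp: affine_hull_2_alt)
    qed
    have "k \<noteq> 0" using k ne by (auto simp: c_def)
    have scale: "det2 c w = k * det2 a w" for w
      by (simp add: k det2_def algebra_simps)
    have "det2 a (z - C) = 0"
      using z2 \<open>k \<noteq> 0\<close> by (simp add: scale)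
    then have "det2 a (w - A) = det2 a (w - C)" for w
      using z1 by (simp add: det2_def algebra_simps)
    then have "line_through A B = line_through C D"
      using ne \<open>k \<noteq> 0\<close> by (simp add: line_through_eq_det2 scale flip: a_def c_def)
    with ln show False ..
  qed
  define p where "p = det2 a A"
  define q where "q = det2 c C"
  have "fst z * det2 a c = fst c * p - fst a * q"
       "snd z * det2 a c = snd c * p - snd a * q"
    using z1 z2 unfolding det2_def p_def q_def fst_diff snd_diff by - algebra+
  then have "fst z = (fst c * p - fst a * q) / det2 a c"
       "snd z = (snd c * p - snd a * q) / det2 a c"
    using \<open>det2 a c \<noteq> 0\<close> by (simp_all add: field_simps)
  moreover have "p \<in> \<rat>" "q \<in> \<rat>" "det2 a c \<in> \<rat>"
    using rat by (auto simp: p_def q_def det2_def)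
  ultimately show "z \<in> \<rat> \<times> \<rat>"
    using rat by (auto simp: mem_Times_iff)
qed

section \<open>Sets closed under intersecting lines\<close>

definition meet_closed :: "(real \<times> real) set \<Rightarrow> bool" where
  "meet_closed U \<longleftrightarrow> intersection_points U \<subseteq> U"

text \<open>
  The condition \<open>C \<notin> line_through A B\<close> makes the two lines distinct in a form that is easy to verify
  in coordinates. In the degenerate cases \<open>A = B\<close> and \<open>C = D\<close>, \<open>z\<close> is one of the given points.
\<close>

lemma meet_closedD:
  assumes "meet_closed U" "A \<in> U" "B \<in> U" "C \<in> U" "D \<in> U"
    and "z \<in> line_through A B" "z \<in> line_through C D" "C \<notin> line_through A B"
  shows "z \<in> U"
proof (cases "A = B \<or> C = D")
  case True
  then show ?thesis using assms by auto
next
  case False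
  have "C \<in> line_through C D" by (simp add: hull_inc)
  then have "line_through A B \<noteq> line_through C D" using assms(8) by metis
  then have "z \<in> intersection_points U"
    using assms False by (intro intersection_pointsI[of A U B C D]) auto
  then show ?thesis using assms(1) by (auto simp: meet_closed_def)
qed

lemma meet_closed_iterates:
  assumes "\<not> collinear S"
  shows "meet_closed (\<Union>i. (intersection_points ^^ i) S)"
proof -
  let ?T = "\<lambda>i. (intersection_points ^^ i) S"
  have step: "?T i \<subseteq> ?T (Suc i)" for i
  proof (induction i)
    case 0
    then show ?case using intersection_points_extensive[OF assms] by simp
  next
    case (Suc i)
    then show ?case using intersection_points_mono[OF Suc] by simp
  qed
  then have mono: "?T i \<subseteq> ?T j" if "i \<le> j" for i j
    using that by (rule lift_Suc_mono_le)
  show ?thesis unfolding meet_closed_def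
  proof
    fix z assume "z \<in> intersection_points (\<Union>i. ?T i)"
    then obtain A B C D where m: "A \<in> (\<Union>i. ?T i)" "B \<in> (\<Union>i. ?T i)" "C \<in> (\<Union>i. ?T i)" "D \<in> (\<Union>i. ?T i)"
      and z: "A \<noteq> B" "C \<noteq> D" "line_through A B \<noteq> line_through C D"
        "z \<in> line_through A B" "z \<in> line_through C D"
      by (rule intersection_pointsE)
    obtain a b c d where "A \<in> ?T a" "B \<in> ?T b" "C \<in> ?T c" "D \<in> ?T d"
      using m by blast
    then have "{A, B, C, D} \<subseteq> ?T (a + b + c + d)"
      using mono[of a "a+b+c+d"] mono[of b "a+b+c+d"] mono[of c "a+b+c+d"] mono[of d "a+b+c+d"]
      by auto
    then have "z \<in> intersection_points (?T (a + b + c + d))"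
      using z by (intro intersection_pointsI[of A _ B C D]) auto
    then have "z \<in> ?T (Suc (a + b + c + d))" by simp
    then show "z \<in> (\<Union>i. ?T i)" by blast
  qed
qed

text \<open>
  Injective affine maps send lines to lines and keep distinct lines distinct, so the closure property
  can be studied in any affine frame. It is used below for the frame of the trapezoid and for the
  reflection that exchanges its two parallel sides.
\<close>

lemma meet_closed_affine_vimage:
  fixes f :: "real \<times> real \<Rightarrow> real \<times> real"
  assumes "meet_closed U" "linear f" "inj f"
  shows "meet_closed ((\<lambda>z. a + f z) -` U)"
  unfolding meet_closed_def
proof
  let ?g = "\<lambda>z. a + f z"
  have inj: "inj ?g" using assms(3) by (simp only: inj_def add_left_cancel)
  have line: "?g ` line_through A B = line_through (?g A) (?g B)" for A B
  proof -
    have "?g ` line_through A B = (+) a ` (f ` line_through A B)"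
      by (rule image_image[symmetric])
    also have "\<dots> = line_through (?g A) (?g B)"
      unfolding affine_hull_linear_image[OF assms(2)[THEN linear_conv_bounded_linear[THEN iffD1]]]
        affine_hull_translation[symmetric] image_insert image_empty ..
    finally show ?thesis .
  qed
  fix z assume "z \<in> intersection_points (?g -` U)"
  then obtain A B C D where m: "A \<in> ?g -` U" "B \<in> ?g -` U" "C \<in> ?g -` U" "D \<in> ?g -` U"
    and z: "A \<noteq> B" "C \<noteq> D" "line_through A B \<noteq> line_through C D"
      "z \<in> line_through A B" "z \<in> line_through C D"
    by (rule intersection_pointsE)
  have "?g z \<in> intersection_points U"
  proof (rule intersection_pointsI[of "?g A" U "?g B" "?g C" "?g D"])
    show "line_through (?g A) (?g B) \<noteq> line_through (?g C) (?g D)"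
      using z(3) unfolding line[symmetric] inj_image_eq_iff[OF inj] .
    show "?g A \<noteq> ?g B" "?g C \<noteq> ?g D"
      using z(1,2) inj_eq[OF inj] by blast+
    show "?g z \<in> line_through (?g A) (?g B)"
      unfolding line[symmetric] using z(4) by (rule imageI)
    show "?g z \<in> line_through (?g C) (?g D)"
      unfolding line[symmetric] using z(5) by (rule imageI)
    show "?g A \<in> U" "?g B \<in> U" "?g C \<in> U" "?g D \<in> U"
      using m unfolding vimage_eq .
  qed
  then show "z \<in> ?g -` U" using assms(1) unfolding meet_closed_def vimage_eq by blast
qed

section \<open>Perspectivities between two parallel rows\<close>

definition row :: "(real \<times> real) set \<Rightarrow> real \<Rightarrow> real set" where
  "row V h = {x. (x, h) \<in> V}"

lemma transversal_iff:
  "(p, h) \<in> line_through (x, 0) (y, 1) \<longleftrightarrow> p = x + h * (y - x)"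
  by (subst line_through_eq_det2) (auto simp: det2_def algebra_simps)

lemma horizontal_iff:
  assumes "x1 \<noteq> x2"
  shows "(p, h) \<in> line_through (x1, k) (x2, k) \<longleftrightarrow> h = k"
  using assms by (subst line_through_eq_det2) (auto simp: det2_def)

lemma transversals_meet:
  assumes "meet_closed V" "x1 \<in> row V 0" "x2 \<in> row V 0" "y1 \<in> row V 1" "y2 \<in> row V 1"
    and "x1 \<noteq> x2" "p = x1 + h * (y1 - x1)" "p = x2 + h * (y2 - x2)"
  shows "(p, h) \<in> V"
  by (rule meet_closedD[OF assms(1), of "(x1, 0)" "(y1, 1)" "(x2, 0)" "(y2, 1)"])
    (use assms in \<open>auto simp: row_def transversal_iff\<close>)

text \<open>
  The lines \<open>x1 y1\<close> and \<open>x2 y2\<close> meet in a point \<open>(p, h)\<close>, because \<open>y2 - y1 \<noteq> x2 - x1\<close> prevents them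
  from being parallel. Projection from \<open>(p, h)\<close> maps the row at height \<open>0\<close> to the row at height \<open>1\<close>
  by the affine map that takes \<open>x1\<close> to \<open>y1\<close> and \<open>x2\<close> to \<open>y2\<close>.
\<close>

lemma row_perspectivity:
  assumes V: "meet_closed V" and x: "x1 \<in> row V 0" "x2 \<in> row V 0" "x \<in> row V 0"
    and y: "y1 \<in> row V 1" "y2 \<in> row V 1"
    and ne: "x1 \<noteq> x2" "y1 \<noteq> y2" "y2 - y1 \<noteq> x2 - x1"
  shows "y1 + (x - x1) * (y2 - y1) / (x2 - x1) \<in> row V 1"
proof -
  define d where "d = x2 - x1"
  define e where "e = y2 - y1"
  have de: "d \<noteq> 0" "e \<noteq> 0" "d - e \<noteq> 0" using ne by (auto simp: d_def e_def)
  have x2: "x2 = x1 + d" and y2: "y2 = y1 + e" by (auto simp: d_def e_def)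
  define h where "h = d / (d - e)"
  define p where "p = x1 + h * (y1 - x1)"
  define z where "z = y1 + (x - x1) * e / d"
  have h: "h \<noteq> 0" "h \<noteq> 1" "h * (d - e) = d" using de by (auto simp: h_def field_simps)
  have "p = x2 + h * (y2 - x2)"
    using h(3) by (simp add: p_def x2 y2 algebra_simps)
  then have c: "(p, h) \<in> V"
    using V x y ne(1) by (intro transversals_meet[of V x1 x2 y1 y2]) (auto simp: p_def)
  have "(z, 1) \<in> V"
  proof (rule meet_closedD[OF V])
    show "(y1, 1) \<in> V" "(y2, 1) \<in> V" "(x, 0) \<in> V" using x y by (auto simp: row_def)
    show "(p, h) \<in> V" by (rule c)
    show "(z, 1) \<in> line_through (y1, 1) (y2, 1)" "(x, 0) \<notin> line_through (y1, 1) (y2, 1)"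
      using ne by (simp_all add: horizontal_iff)
    have "z = x + (p - x) / h"
      using de by (simp add: z_def p_def h_def field_simps)
    then have "(z, 1) = (x, 0) + (1 / h) *\<^sub>R ((p, h) - (x, 0))"
      using h by simp
    then show "(z, 1) \<in> line_through (x, 0) (p, h)"
      by (rule in_line_throughI)
  qed
  then show ?thesis by (simp add: row_def z_def d_def e_def)
qed

text \<open>
  In the trapezoid with parallel sides \<open>x1 x2\<close> and \<open>y1 y2\<close>, both the lines \<open>x1 y1\<close>, \<open>x2 y2\<close> and the
  lines \<open>x1 y2\<close>, \<open>x2 y1\<close> meet on the line joining the midpoints \<open>m\<close> and \<open>n\<close> of the parallel sides.
  Both meets exist as the parallel sides have different lengths, and they are at different heights
  \<open>h\<close> and \<open>k\<close>, so they determine this line, which cuts the bottom row in \<open>m\<close>.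
\<close>

lemma row_midpoint:
  assumes V: "meet_closed V" and x: "x1 \<in> row V 0" "x2 \<in> row V 0"
    and y: "y1 \<in> row V 1" "y2 \<in> row V 1"
    and ne: "x1 \<noteq> x2" "y1 \<noteq> y2" "\<bar>y2 - y1\<bar> \<noteq> \<bar>x2 - x1\<bar>"
  shows "(x1 + x2) / 2 \<in> row V 0"
proof -
  define d where "d = x2 - x1"
  define e where "e = y2 - y1"
  have de: "d \<noteq> 0" "e \<noteq> 0" "d - e \<noteq> 0" "d + e \<noteq> 0" using ne by (auto simp: d_def e_def abs_eq_iff)
  define m where "m = (x1 + x2) / 2"
  define n where "n = (y1 + y2) / 2"
  have xs: "x1 = m - d / 2" "x2 = m + d / 2" and ys: "y1 = n - e / 2" "y2 = n + e / 2"
    by (auto simp: m_def n_def d_def e_def field_simps)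
  define h where "h = d / (d - e)"
  define k where "k = d / (d + e)"
  have h: "h \<noteq> 0" "h * (d - e) = d" and k: "k * (d + e) = d" using de by (auto simp: h_def k_def)
  have "k - h \<noteq> 0" using de by (auto simp: h_def k_def divide_simps)
  have ch: "(m + h * (n - m), h) \<in> V"
  proof (rule transversals_meet[OF V x y ne(1)])
    show "m + h * (n - m) = x1 + h * (y1 - x1)" "m + h * (n - m) = x2 + h * (y2 - x2)"
      using h(2) by (auto simp: xs ys algebra_simps)
  qed
  have ck: "(m + k * (n - m), k) \<in> V"
  proof (rule transversals_meet[OF V x y(2,1) ne(1)])
    show "m + k * (n - m) = x1 + k * (y2 - x1)" "m + k * (n - m) = x2 + k * (y1 - x2)"
      using k by (auto simp: xs ys algebra_simps)
  qed
  have "(m, 0) \<in> V"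
  proof (rule meet_closedD[OF V])
    show "(x1, 0) \<in> V" "(x2, 0) \<in> V" using x by (auto simp: row_def)
    show "(m + h * (n - m), h) \<in> V" "(m + k * (n - m), k) \<in> V" by fact+
    show "(m, 0) \<in> line_through (x1, 0) (x2, 0)"
      "(m + h * (n - m), h) \<notin> line_through (x1, 0) (x2, 0)"
      using ne h by (auto simp: horizontal_iff)
    define u where "u = - h / (k - h)"
    have u: "u * (k - h) = - h" using \<open>k - h \<noteq> 0\<close> by (simp add: u_def)
    have "u * (k * (n - m) - h * (n - m)) = - h * (n - m)"
      using u by algebra
    then have "(m, 0) = (m + h * (n - m), h) + u *\<^sub>R ((m + k * (n - m), k) - (m + h * (n - m), h))"
      using u by simp
    then show "(m, 0) \<in> line_through (m + h * (n - m), h) (m + k * (n - m), k)"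
      by (rule in_line_throughI)
  qed
  then show ?thesis by (simp add: row_def m_def)
qed

section \<open>Arithmetic on a row\<close>

text \<open>
  The one-dimensional content of the two constructions, for a bottom row \<open>X\<close> and a top row \<open>Y\<close>. The
  properties come in pairs, exchanged by the reflection that swaps the rows, and the arithmetic below
  uses nothing else about the plane.
\<close>

locale linked_rows =
  fixes X Y :: "real set" and t :: real
  assumes base: "0 \<in> X" "1 \<in> X" "0 \<in> Y" "t \<in> Y"
    and t: "t \<noteq> 0" "t \<noteq> 1" "t \<noteq> -1"
    and transport: "\<lbrakk>x1 \<in> X; x2 \<in> X; x \<in> X; y1 \<in> Y; y2 \<in> Y; x1 \<noteq> x2; y1 \<noteq> y2; y2 - y1 \<noteq> x2 - x1\<rbrakk>
        \<Longrightarrow> y1 + (x - x1) * (y2 - y1) / (x2 - x1) \<in> Y"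
    and transport_back: "\<lbrakk>y1 \<in> Y; y2 \<in> Y; y \<in> Y; x1 \<in> X; x2 \<in> X; y1 \<noteq> y2; x1 \<noteq> x2; x2 - x1 \<noteq> y2 - y1\<rbrakk>
        \<Longrightarrow> x1 + (y - y1) * (x2 - x1) / (y2 - y1) \<in> X"
    and midpoint: "\<lbrakk>x1 \<in> X; x2 \<in> X; y1 \<in> Y; y2 \<in> Y; x1 \<noteq> x2; y1 \<noteq> y2; \<bar>y2 - y1\<bar> \<noteq> \<bar>x2 - x1\<bar>\<rbrakk>
        \<Longrightarrow> (x1 + x2) / 2 \<in> X"
    and midpoint_back: "\<lbrakk>y1 \<in> Y; y2 \<in> Y; x1 \<in> X; x2 \<in> X; y1 \<noteq> y2; x1 \<noteq> x2; \<bar>x2 - x1\<bar> \<noteq> \<bar>y2 - y1\<bar>\<rbrakk>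
        \<Longrightarrow> (y1 + y2) / 2 \<in> Y"
begin

lemma half_t: "t / 2 \<in> Y"
  using midpoint_back[of 0 t 0 1] base t by (simp add: abs_eq_iff)

text \<open>
  The midpoint of \<open>x1\<close> and \<open>x2\<close> needs two points of \<open>Y\<close> at a distance other than \<open>\<bar>x2 - x1\<bar>\<close>. The
  distances \<open>\<bar>t\<bar>\<close> and \<open>\<bar>t / 2\<bar>\<close> both occur in \<open>Y\<close>, and one of them will do.
\<close>

lemma X_midpoint:
  assumes "x1 \<in> X" "x2 \<in> X"
  shows "(x1 + x2) / 2 \<in> X"
proof (cases "x1 = x2")
  case False
  have "\<bar>t\<bar> \<noteq> \<bar>x2 - x1\<bar> \<or> \<bar>t / 2\<bar> \<noteq> \<bar>x2 - x1\<bar>"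
    using t by linarith
  then show ?thesis
    using midpoint[of x1 x2 0 t] midpoint[of x1 x2 0 "t / 2"] False assms base half_t t
    by (metis diff_zero divide_eq_0_iff zero_neq_numeral)
qed (use assms in simp)

lemma X_half: "x \<in> X \<Longrightarrow> x / 2 \<in> X"
  using X_midpoint[of 0 x] base by simp

lemma scale_XY: "\<lbrakk>a \<in> X; b \<in> Y; a \<noteq> 0; b \<noteq> 0; a \<noteq> b; x \<in> X\<rbrakk> \<Longrightarrow> x * b / a \<in> Y"
  using transport[of 0 a x 0 b] base by auto

lemma scale_YX: "\<lbrakk>b \<in> Y; a \<in> X; a \<noteq> 0; b \<noteq> 0; a \<noteq> b; y \<in> Y\<rbrakk> \<Longrightarrow> y * a / b \<in> X"
  using transport_back[of 0 b y 0 a] base by auto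

lemma times_t: "x \<in> X \<Longrightarrow> x * t \<in> Y"
  using scale_XY[of 1 t x] base t by auto

lemma divide_t: "y \<in> Y \<Longrightarrow> y / t \<in> X"
  using scale_YX[of t 1 y] base t by auto

text \<open>
  The factor \<open>2\<close> is composed of a scaling to \<open>Y\<close> and a scaling back to \<open>X\<close>, neither of which may have
  factor \<open>1\<close>. The factors \<open>t\<close> and \<open>2 / t\<close> are suitable unless \<open>t = 2\<close>, when \<open>4\<close> and \<open>1 / 2\<close> are used.
\<close>

lemma X_double:
  assumes "x \<in> X"
  shows "2 * x \<in> X"
proof (cases "t = 2")
  case True
  have "x * t / (1 / 2) \<in> Y"
    using scale_XY[of "1 / 2" t x] X_half[of 1] assms base True by auto
  from divide_t[OF this] show ?thesis using True by simp
next
  case False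
  have "x * t * 1 / (t / 2) \<in> X"
    using scale_YX[of "t / 2" 1 "x * t"] times_t[OF assms] half_t base t False by auto
  then show ?thesis using t by (simp add: mult.commute)
qed

lemma X_add: "\<lbrakk>x \<in> X; y \<in> X\<rbrakk> \<Longrightarrow> x + y \<in> X"
  using X_double[of "(x + y) / 2"] X_midpoint[of x y] by (simp del: distrib_left_numeral)

lemma X_uminus:
  assumes "x \<in> X"
  shows "- x \<in> X"
proof -
  \<comment> \<open>The perspectivity with \<open>0 \<mapsto> t\<close> and \<open>1 \<mapsto> 0\<close>, followed by division by \<open>t\<close>. It has
    factor \<open>- t\<close>, which differs from \<open>1\<close> because the trapezoid is no parallelogram.\<close>
  have refl: "1 - u \<in> X" if "u \<in> X" for u
  proof -
    have "t + u * (0 - t) \<in> Y"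
      using transport[of 0 1 u t 0] base t that by auto
    from divide_t[OF this] show ?thesis using t by (simp add: add_divide_distrib diff_divide_distrib)
  qed
  have "1 - 2 \<in> X" using refl[of 2] X_double[of 1] base by simp
  from X_add[OF refl[OF assms] this] show ?thesis by simp
qed

text \<open>
  Scaling to \<open>Y\<close> by \<open>y t / z\<close> and dividing by \<open>t\<close> multiplies by \<open>y / z\<close>. The scaling is unavailable
  for \<open>y t = z\<close>; then \<open>2 y\<close> takes the place of \<open>y\<close>, and the result is halved.
\<close>

lemma X_mult_divide:
  assumes "x \<in> X" "y \<in> X" "z \<in> X" "z \<noteq> 0"
  shows "x * y / z \<in> X"
proof -
  have main: "x * u / z \<in> X" if "u \<in> X" "u \<noteq> 0" "u * t \<noteq> z" for u
  proof -
    have "x * (u * t) / z \<in> Y"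
      using scale_XY[of z "u * t" x] times_t[of u] assms that t by auto
    from divide_t[OF this] show ?thesis using t by simp
  qed
  consider "y = 0" | "y \<noteq> 0" "y * t \<noteq> z" | "y \<noteq> 0" "(2 * y) * t \<noteq> z"
    using assms(4) by force
  then show ?thesis
  proof cases
    case 3
    then have "x * (2 * y) / z \<in> X" using main X_double assms by simp
    from X_half[OF this] show ?thesis by simp
  qed (use assms base main in auto)
qed

lemma Rats_subset_X: "\<rat> \<subseteq> X"
proof
  have nat: "of_nat n \<in> X" for n
    by (induction n) (use base X_add in auto)
  have int: "of_int i \<in> X" for i
    by (cases i rule: int_cases2) (use nat X_uminus in auto)
  fix r :: real assume "r \<in> \<rat>"
  then obtain a b :: int where "b > 0" "r = of_int a / of_int b"
    by (rule Rats_cases') auto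
  then show "r \<in> X"
    using X_mult_divide[of "of_int a" 1 "of_int b"] int base by auto
qed

lemma Rats_subset_Y:
  assumes "t \<in> \<rat>"
  shows "\<rat> \<subseteq> Y"
proof
  fix r :: real assume "r \<in> \<rat>"
  then have "r / t \<in> X" using assms Rats_subset_X by auto
  from times_t[OF this] show "r \<in> Y" using t by simp
qed

end

section \<open>Trapezoids\<close>

lemma standard_trapezoid_generates:
  assumes V: "meet_closed V" and mem: "(0, 0) \<in> V" "(1, 0) \<in> V" "(0, 1) \<in> V" "(t, 1) \<in> V"
    and t_rat: "t \<in> \<rat>" and t: "t \<noteq> 0" "t \<noteq> 1" "t \<noteq> -1"
  shows "\<rat> \<times> \<rat> \<subseteq> V"
proof -
  let ?f = "\<lambda>z::real \<times> real. (fst z, - snd z)"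
  define W where "W = (\<lambda>z. (0, 1) + ?f z) -` V"
  \<comment> \<open>The reflection \<open>(x, h) \<mapsto> (x, 1 - h)\<close> exchanges the rows and so yields the maps from the
    top row to the bottom row.\<close>
  have W: "meet_closed W"
    unfolding W_def using V
    by (intro meet_closed_affine_vimage) (auto intro!: linearI simp: inj_def prod_eq_iff)
  have rows: "row W 0 = row V 1" "row W 1 = row V 0"
    by (auto simp: row_def W_def)
  interpret linked_rows "row V 0" "row V 1" t
  proof unfold_locales
    show "0 \<in> row V 0" "1 \<in> row V 0" "0 \<in> row V 1" "t \<in> row V 1"
      using mem by (auto simp: row_def)
  qed (use t row_perspectivity[OF V] row_perspectivity[OF W] row_midpoint[OF V] row_midpoint[OF W]
      in \<open>simp_all add: rows\<close>)
  show ?thesis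
  proof
    fix z :: "real \<times> real" assume "z \<in> \<rat> \<times> \<rat>"
    then obtain a b where z: "z = (a, b)" "a \<in> \<rat>" "b \<in> \<rat>" by blast
    show "z \<in> V"
    proof (cases "b = 0")
      case True
      then show ?thesis using z Rats_subset_X by (auto simp: row_def)
    next
      case False
      \<comment> \<open>The line from \<open>(x, 0)\<close> through \<open>(a, b)\<close> meets the top row in \<open>(y x, 1)\<close>; the lines
        for \<open>x = 0\<close> and \<open>x = 1\<close> determine \<open>(a, b)\<close>.\<close>
      define y where "y x = x + (a - x) / b" for x
      have "y 0 \<in> row V 1" "y 1 \<in> row V 1"
        using z Rats_subset_Y[OF t_rat] by (auto simp: y_def)
      moreover have "a = 0 + b * (y 0 - 0)" "a = 1 + b * (y 1 - 1)"
        using False by (simp_all add: y_def)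
      ultimately show ?thesis
        unfolding z(1) using base by (intro transversals_meet[OF V, of 0 1 "y 0" "y 1"]) auto
    qed
  qed
qed

lemma affine_parallel_translate:
  fixes a b c d :: "real \<times> real"
  assumes "c - a = d - b"
  shows "affine_parallel (line_through a b) (line_through c d)"
proof -
  have "line_through c d = (+) (c - a) ` line_through a b"
    using assms affine_hull_translation[of "c - a" "{a, b}"] by (simp add: algebra_simps)
  then show ?thesis unfolding affine_parallel_def by blast
qed

lemma affine_parallel_direction:
  fixes R Q P T :: "real \<times> real"
  assumes "affine_parallel (line_through R Q) (line_through P T)"
  obtains t where "T - P = t *\<^sub>R (Q - R)"
proof -
  obtain a where a: "line_through P T = (+) a ` line_through R Q"
    using assms unfolding affine_parallel_def by blast
  have "P \<in> line_through P T" "T \<in> line_through P T" by (auto intro: hull_inc)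
  then obtain u v where PT: "P = a + (R + u *\<^sub>R (Q - R))" "T = a + (R + v *\<^sub>R (Q - R))"
    unfolding a unfolding affine_hull_2_alt by blast
  have "T - P = (v - u) *\<^sub>R (Q - R)"
    by (simp only: PT add_diff_cancel_left scaleR_left_diff_distrib)
  then show ?thesis by (rule that)
qed

theorem theorem1p6:
  fixes S :: "(real \<times> real) set" and R P Q T :: "real \<times> real"
  assumes "S \<subseteq> \<rat> \<times> \<rat>"
    and "R \<in> S" and "P \<in> S" and "Q \<in> S" and "T \<in> S"
    and "R \<noteq> Q" and "P \<noteq> T" and "R \<noteq> P" and "Q \<noteq> T"
    and "affine_parallel (line_through R Q) (line_through P T)"
    and "line_through R Q \<noteq> line_through P T"
    and "\<not> affine_parallel (line_through R P) (line_through Q T)"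
    and not_parallelogram: "\<not> affine_parallel (line_through R T) (line_through Q P)"
  shows "(\<Union>i::nat. (intersection_points ^^ i) S) = \<rat> \<times> \<rat>"
proof
  let ?U = "\<Union>i::nat. (intersection_points ^^ i) S"
  have "(intersection_points ^^ i) S \<subseteq> \<rat> \<times> \<rat>" for i
    by (induction i) (use assms(1) intersection_points_rational in auto)
  then show "?U \<subseteq> \<rat> \<times> \<rat>" by blast
  define v where "v = Q - R"
  define w where "w = P - R"
  obtain t where t: "T - P = t *\<^sub>R v"
    using affine_parallel_direction[OF assms(10)] unfolding v_def by blast
  have t0: "t \<noteq> 0" using t assms(7) by auto
  \<comment> \<open>For \<open>t = 1\<close> and \<open>t = -1\<close> the four points would be the vertices of a parallelogram, with
    sides \<open>RP\<close> and \<open>QT\<close> in the first case, \<open>RT\<close> and \<open>QP\<close> in the second.\<close>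
  have t1: "t \<noteq> 1"
  proof
    assume "t = 1"
    then have "Q - R = T - P" using t by (simp add: v_def)
    from affine_parallel_translate[OF this] show False using assms(12) by simp
  qed
  have tm1: "t \<noteq> -1"
  proof
    assume "t = -1"
    then have "Q - R = P - T" using t by (simp add: v_def algebra_simps)
    from affine_parallel_translate[OF this] show False using not_parallelogram by simp
  qed
  have rat: "fst R \<in> \<rat>" "snd R \<in> \<rat>" "fst v \<in> \<rat>" "snd v \<in> \<rat>" "fst w \<in> \<rat>" "snd w \<in> \<rat>"
    "fst (T - P) \<in> \<rat>" "snd (T - P) \<in> \<rat>"
    using assms(2-5)[THEN subsetD[OF assms(1)]] by (auto simp: v_def w_def)
  have "fst v \<noteq> 0 \<or> snd v \<noteq> 0" using assms(6) by (auto simp: v_def prod_eq_iff)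
  then have "t = fst (T - P) / fst v \<or> t = snd (T - P) / snd v"
    unfolding t by auto
  then have trat: "t \<in> \<rat>" using rat by auto
  \<comment> \<open>\<open>P\<close> is off the line \<open>RQ\<close>: parallel lines with a common point would coincide.\<close>
  have det: "det2 v w \<noteq> 0"
  proof
    assume "det2 v w = 0"
    moreover have "det2 (T - P) (z - P) = t * (det2 v (z - R) - det2 v w)" for z
      unfolding t by (simp add: det2_def w_def algebra_simps)
    ultimately have "det2 (T - P) (z - P) = t * det2 (Q - R) (z - R)" for z
      by (simp add: v_def)
    then have "line_through R Q = line_through P T"
      using assms(6,7) t0 by (simp add: line_through_eq_det2)
    with assms(11) show False ..
  qed
  have "P \<notin> line_through R Q"
    using det assms(6) by (simp add: line_through_eq_det2 v_def w_def)
  then have "\<not> collinear {R, Q, P}"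
    using assms(6) by (simp add: collinear_3_affine_hull)
  then have "\<not> collinear S"
    using assms(2-4) collinear_subset[of S "{R, Q, P}"] by auto
  then have U: "meet_closed ?U" by (rule meet_closed_iterates)
  define f where "f z = fst z *\<^sub>R v + snd z *\<^sub>R w" for z :: "real \<times> real"
  have lin: "linear f" by (rule linearI) (auto simp: f_def algebra_simps)
  have "z = 0" if "f z = 0" for z
  proof -
    have "fst z * fst v + snd z * fst w = 0" "fst z * snd v + snd z * snd w = 0"
      using that by (auto simp: f_def prod_eq_iff)
    then have "fst z * det2 v w = 0" "snd z * det2 v w = 0"
      unfolding det2_def by algebra+
    then show ?thesis using det by (auto simp: prod_eq_iff)
  qed
  then have "inj f" using lin by (simp add: linear_injective_0)
  then have V: "meet_closed ((\<lambda>z. R + f z) -` ?U)" (is "meet_closed ?V")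
    using U lin by (intro meet_closed_affine_vimage)
  have "S \<subseteq> ?U" by (rule order.trans[OF _ UN_upper[of 0]]) auto
  moreover have "R + f (0, 0) = R" "R + f (1, 0) = Q" "R + f (0, 1) = P" "R + f (t, 1) = T"
    using t by (auto simp: f_def v_def w_def algebra_simps)
  ultimately have "\<rat> \<times> \<rat> \<subseteq> ?V"
    using assms(2-5) trat t0 t1 tm1 by (intro standard_trapezoid_generates[OF V, of t]) auto
  show "\<rat> \<times> \<rat> \<subseteq> ?U"
  proof
    fix z :: "real \<times> real" assume z: "z \<in> \<rat> \<times> \<rat>"
    \<comment> \<open>The coordinates of \<open>z\<close> in the frame \<open>R, v, w\<close>, by Cramer's rule.\<close>
    define c where "c = (det2 (z - R) w / det2 v w, det2 v (z - R) / det2 v w)"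
    have "c \<in> \<rat> \<times> \<rat>"
      using z rat by (auto simp: c_def det2_def mem_Times_iff)
    then have "R + f c \<in> ?U" using \<open>\<rat> \<times> \<rat> \<subseteq> ?V\<close> by blast
    moreover have "f c = z - R"
    proof -
      have "det2 (z - R) w * fst v + det2 v (z - R) * fst w = det2 v w * fst (z - R)"
        "det2 (z - R) w * snd v + det2 v (z - R) * snd w = det2 v w * snd (z - R)"
        unfolding det2_def by algebra+
      then show ?thesis using det by (auto simp: f_def c_def prod_eq_iff field_simps)
    qed
    ultimately show "z \<in> ?U" by simp
  qed
qed

end
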